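(* Let $F$ be the observed random vector in $\mathbb{R}^2$, $F\sim\mathcal N(H,\hat C)$, where $H\in\mathbb{R}^2$ is the true (unknown) parameter value and $\hat C$ is the known covariance matrix given in the context. Let $\alpha\in(0,1)$. Then a confidence region for $H$ at the level $1-\alpha$ is given by the random set $$\mathrm{CR}_\alpha(F)=\big\{H'\in\mathbb{R}^2:\ \big((F-H')^T\hat C^{-1}(F-H')\big)^{1/2}\le(-2\ln\alpha)^{1/2}\big\}.$$ That is, for every $H\in\mathbb{R}^2$, if $F\sim\mathcal N(H,\hat C)$ then $\mathbb P\big(H\in\mathrm{CR}_\alpha(F)\big)\ge1-\alpha$.
   Context: A confidence region at level $1-\alpha$ is a map $F\mapsto\mathrm{CR}(F)\subset\mathbb{R}^2$ such that $\mathbb P(H\in\mathrm{CR}(F))\ge1-\alpha$ whenever $F\sim\mathcal N(H,\hat C)$, for every $H\in\mathbb{R}^2$. The covariance matrix is $$\hat C_{i,j}=\int_{B_\rho(\mathbf 0)}\int_{B_\rho(\mathbf 0)}\check x_i\,\check y_j\,C(\check{\mathbf x}-\check{\mathbf y})\,d\check{\mathbf x}\,d\check{\mathbf y},\quad i,j\in\{1,2\},$$ where $\rho>0$, $B_\rho(\mathbf 0)$ is the closed disk of radius $\rho$ centered at $\mathbf 0$ in $\mathbb{R}^2$, and $$C(\check{\mathbf x})=\Big(\frac{\kappa}{4\pi}\Big)^2\int_0^{2\pi}\sigma^2(\alpha,\vec\alpha\cdot\mathbf x_0)\,(\varphi'\star\varphi')(\vec\alpha\cdot\check{\mathbf x})\,d\alpha,\qquad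 (g\star h)(t)=\int_{\mathbb R}g(t+s)h(s)\,ds,\quad \vec\alpha=(\cos\alpha,\sin\alpha)$$ (here $\alpha$ is an angle of integration). In this formula $\kappa>0$, $P>0$; $\sigma\in C^1([-\pi,\pi]\times[-P,P])$ (angle taken modulo $2\pi$) satisfies $\sigma(\alpha,p)=\sigma(\alpha+\pi,-p)$; $\mathbf x_0\in\mathbb{R}^2$ satisfies $|\mathbf x_0|<P$ and $\sigma^2(\alpha,\vec\alpha\cdot\mathbf x_0)\neq0$ for all $\alpha$ in some nonempty open subset of $[0,2\pi]$; and $\varphi:\mathbb{R}\to\mathbb{R}$ is compactly supported with $\varphi^{(M+1)}\in L^\infty(\mathbb{R})$ for some $M\ge3$ and $\sum_{k\in\mathbb Z}\varphi(t-k)k^j\equiv t^j$ for $j=0,1$ (hence $\int\varphi=1$). In the application, $F$ is the integral of $\check{\mathbf y}$ times the locally rescaled noisy reconstruction over $B_\rho(\mathbf 0)$, and its mean $H$ encodes the direction and magnitude of an image edge at $\mathbf x_0$. *)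

theory Defs
  imports "HOL-Probability.Probability"
begin

section \<open>Normal random vectors and confidence regions\<close>

definition std_gaussian :: "(real^'n) measure" where
  "std_gaussian = density lborel (\<lambda>z. ennreal (\<Prod>i\<in>UNIV. std_normal_density (z $ i)))"

text \<open>\<open>N\<close> is the law of \<open>\<mu> + A Z\<close>, where \<open>Z\<close> has independent standard normal components and
  \<open>A A\<^sup>T = \<Sigma>\<close>. This law depends on \<open>A\<close> only through \<open>\<Sigma>\<close>. A singular \<open>\<Sigma>\<close> is allowed, so that
  assuming normality of a vector does not assume that its covariance matrix is invertible.\<close>

definition normal_law :: "real^'n \<Rightarrow> real^'n^'n \<Rightarrow> (real^'n) measure \<Rightarrow> bool" where
  "normal_law \<mu> \<Sigma> N \<longleftrightarrow>
     (\<exists>A :: real^'n^'n. A ** transpose A = \<Sigma> \<and> N = distr std_gaussian borel (\<lambda>z. \<mu> + A *v z))"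

definition normal_vector ::
    "'s measure \<Rightarrow> ('s \<Rightarrow> real^'n) \<Rightarrow> real^'n \<Rightarrow> real^'n^'n \<Rightarrow> bool" where
  "normal_vector M F \<mu> \<Sigma> \<longleftrightarrow> F \<in> borel_measurable M \<and> normal_law \<mu> \<Sigma> (distr M borel F)"

text \<open>Whether \<open>CR\<close> is a confidence region depends only on the law \<open>N\<close> of the observation, so we
  quantify over laws rather than over random vectors on varying probability spaces.\<close>

definition confidence_region ::
    "real^'n^'n \<Rightarrow> real \<Rightarrow> (real^'n \<Rightarrow> (real^'n) set) \<Rightarrow> bool" where
  "confidence_region \<Sigma> p CR \<longleftrightarrow>
     (\<forall>H N. normal_law H \<Sigma> N \<longrightarrow>
        {f. H \<in> CR f} \<in> sets N \<and> measure N {f. H \<in> CR f} \<ge> p)"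

definition CR_ellipse :: "real^'n^'n \<Rightarrow> real \<Rightarrow> real^'n \<Rightarrow> (real^'n) set" where
  "CR_ellipse \<Sigma> \<alpha> F =
     {H. sqrt ((F - H) \<bullet> (matrix_inv \<Sigma> *v (F - H))) \<le> sqrt (- 2 * ln \<alpha>)}"


section \<open>The covariance matrix\<close>

definition dir :: "real \<Rightarrow> real^2" where
  "dir a = vector [cos a, sin a]"

definition cross_corr :: "(real \<Rightarrow> real) \<Rightarrow> (real \<Rightarrow> real) \<Rightarrow> real \<Rightarrow> real" where
  "cross_corr g h t = (\<integral>s. g (t + s) * h s \<partial>lborel)"

definition cov_fun ::
    "real \<Rightarrow> (real \<Rightarrow> real \<Rightarrow> real) \<Rightarrow> (real \<Rightarrow> real) \<Rightarrow> real^2 \<Rightarrow> real^2 \<Rightarrow> real" where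
  "cov_fun \<kappa> \<sigma> \<phi> x0 x =
     (\<kappa> / (4 * pi))\<^sup>2 *
     (LINT a:{0..2 * pi}|lborel.
        (\<sigma> a (dir a \<bullet> x0))\<^sup>2 * cross_corr (deriv \<phi>) (deriv \<phi>) (dir a \<bullet> x))"

definition cov_matrix ::
    "real \<Rightarrow> real \<Rightarrow> (real \<Rightarrow> real \<Rightarrow> real) \<Rightarrow> (real \<Rightarrow> real) \<Rightarrow> real^2 \<Rightarrow> real^2^2" where
  "cov_matrix \<rho> \<kappa> \<sigma> \<phi> x0 =
     (\<chi> i j. LINT x:cball 0 \<rho>|lborel. LINT y:cball 0 \<rho>|lborel.
        x $ i * y $ j * cov_fun \<kappa> \<sigma> \<phi> x0 (x - y))"


section \<open>Regularity conditions\<close>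

text \<open>On the boundary of \<open>S\<close> the derivative is taken within \<open>S\<close> (one-sided).\<close>

definition C1_on :: "'a::real_normed_vector set \<Rightarrow> ('a \<Rightarrow> 'b::real_normed_vector) \<Rightarrow> bool" where
  "C1_on S f \<longleftrightarrow>
     (\<exists>D :: 'a \<Rightarrow> 'a \<Rightarrow>\<^sub>L 'b. continuous_on S D \<and>
        (\<forall>x\<in>S. (f has_derivative blinfun_apply (D x)) (at x within S)))"

text \<open>\<open>f\<^bsup>(m+1)\<^esup> \<in> L\<^sup>\<infinity>(\<real>)\<close>: the classical derivatives exist up to order \<open>m\<close>, and \<open>f\<^bsup>(m)\<^esup>\<close> is
  the indefinite integral of an essentially bounded function \<open>h\<close>, its weak derivative. Thus
  \<open>f\<^bsup>(m+1)\<^esup>\<close> need not exist at every point (as for splines).\<close>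

definition deriv_Suc_Linfty :: "nat \<Rightarrow> (real \<Rightarrow> real) \<Rightarrow> bool" where
  "deriv_Suc_Linfty m f \<longleftrightarrow>
     (\<forall>k<m. \<forall>t. (deriv ^^ k) f differentiable at t) \<and>
     (\<exists>h \<in> borel_measurable lborel. (\<exists>B. AE t in lborel. \<bar>h t\<bar> \<le> B) \<and>
        (\<forall>a b. a \<le> b \<longrightarrow>
           (deriv ^^ m) f b - (deriv ^^ m) f a = (LINT t:{a..b}|lborel. h t)))"

end

theory Submission
  imports Defs "HOL-Real_Asymp.Real_Asymp"
begin

text \<open>Shifting the correlation integral by \<open>dir a \<bullet> y\<close> and applying Fubini gives
  \<open>v\<^sup>T C v = (\<kappa> / 4\<pi>)\<^sup>2 \<integral> \<sigma>\<^sup>2(a) \<integral> G(a,s)\<^sup>2 ds da\<close> with the profile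
  \<open>G(a,s) = \<integral> (v \<bullet> x) \<phi>'(dir a \<bullet> x + s) dx\<close> over the disk. Because \<open>\<integral>\<phi> = 1\<close>, the second moment
  \<open>\<integral> s\<^sup>2 G(a,s) ds\<close> equals \<open>2 \<integral> (v \<bullet> x) (x \<bullet> dir a) dx = 2 w \<bullet> dir a\<close>. If the quadratic form vanishes,
  then \<open>w \<bullet> dir a = 0\<close> for all \<open>a\<close> in an interval on which \<open>\<sigma> \<noteq> 0\<close>, so \<open>w = 0\<close>, so
  \<open>v \<bullet> w = \<integral> (v \<bullet> x)\<^sup>2 dx = 0\<close> and \<open>v = 0\<close>. Hence the covariance matrix \<open>C = A A\<^sup>T\<close> is invertible, and
  for \<open>F = H + A Z\<close> the quadratic form in the confidence region is \<open>|Z|\<^sup>2\<close>, whose tail in the plane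
  is \<open>exp (- r\<^sup>2 / 2)\<close>.\<close>

section \<open>The planar standard Gaussian and confidence ellipses\<close>

lemma std_gaussian_2:
  "(std_gaussian :: (real^2) measure)
    = density lborel (\<lambda>z. ennreal (exp (- (norm z)\<^sup>2 / 2) / (2 * pi)))"
proof -
  have "(\<Prod>i\<in>UNIV. std_normal_density (z $ i)) = exp (- (norm z)\<^sup>2 / 2) / (2 * pi)" for z :: "real^2"
  proof -
    have "(norm z)\<^sup>2 = (z $ 1)\<^sup>2 + (z $ 2)\<^sup>2"
      by (simp add: norm_vec_def L2_set_def sum_2)
    then show ?thesis
      by (simp add: UNIV_2 std_normal_density_def mult_exp_exp power2_eq_square[symmetric]
          add_divide_distrib diff_divide_distrib del: real_sqrt_mult)
  qed
  then show ?thesis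
    unfolding std_gaussian_def by simp
qed

lemma emeasure_annulus:
  assumes "0 \<le> r" "r \<le> s"
  shows "emeasure lborel {z :: real^2. r \<le> norm z \<and> norm z \<le> s} = ennreal (pi * (s\<^sup>2 - r\<^sup>2))"
proof -
  have eq: "{z :: real^2. r \<le> norm z \<and> norm z \<le> s} = cball 0 s - ball 0 r"
    by auto
  have "emeasure lborel (cball 0 s - ball 0 r :: (real^2) set)
      = emeasure lborel (cball 0 s :: (real^2) set) - emeasure lborel (ball 0 r :: (real^2) set)"
    using assms by (intro emeasure_Diff) (auto simp: emeasure_ball)
  also have "\<dots> = ennreal (pi * (s\<^sup>2 - r\<^sup>2))"
    using assms by (simp add: emeasure_ball emeasure_cball unit_ball_vol_2 ennreal_minus right_diff_distrib)
  finally show ?thesis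
    unfolding eq .
qed

text \<open>Writing \<open>exp (- |z|\<^sup>2 / 2)\<close> as the integral of \<open>exp (- t)\<close> over \<open>t \<ge> |z|\<^sup>2 / 2\<close> and exchanging
  the integrals reduces the tail probability to areas of annuli.\<close>

lemma std_gaussian_2_tail:
  assumes "0 \<le> r"
  shows "emeasure std_gaussian {z :: real^2. r \<le> norm z} = ennreal (exp (- r\<^sup>2 / 2))"
proof -
  define c where "c = r\<^sup>2 / 2"
  have c: "0 \<le> c"
    by (simp add: c_def)
  have layer: "ennreal (exp (- a)) = (\<integral>\<^sup>+t. ennreal (exp (- t)) * indicator {a..} t \<partial>lborel)" for a :: real
  proof -
    have "((\<lambda>t :: real. - exp (- t)) \<longlongrightarrow> 0) at_top"
      by real_asymp
    then show ?thesis
      by (subst nn_integral_FTC_atLeast[where F = "\<lambda>t. - exp (- t)" and T = 0])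
         (auto intro!: derivative_eq_intros)
  qed
  have "emeasure std_gaussian {z :: real^2. r \<le> norm z}
     = (\<integral>\<^sup>+z. ennreal (exp (- (norm z)\<^sup>2 / 2) / (2 * pi)) * indicator {z :: real^2. r \<le> norm z} z \<partial>lborel)"
    unfolding std_gaussian_2 by (subst emeasure_density) auto
  also have "\<dots> = (\<integral>\<^sup>+z. (\<integral>\<^sup>+t. ennreal (1 / (2 * pi)) *
       (ennreal (exp (- t)) * indicator {z :: real^2. r \<le> norm z \<and> (norm z)\<^sup>2 / 2 \<le> t} z) \<partial>lborel) \<partial>lborel)"
  proof (intro nn_integral_cong)
    fix z :: "real^2"
    have "ennreal (exp (- (norm z)\<^sup>2 / 2) / (2 * pi)) * indicator {z :: real^2. r \<le> norm z} z
      = ennreal (1 / (2 * pi)) * (ennreal (exp (- ((norm z)\<^sup>2 / 2))) * indicator {z :: real^2. r \<le> norm z} z)"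
      by (simp add: ennreal_mult[symmetric] split: split_indicator)
    also have "\<dots> = (\<integral>\<^sup>+t. ennreal (1 / (2 * pi)) *
       (ennreal (exp (- t)) * indicator {z :: real^2. r \<le> norm z \<and> (norm z)\<^sup>2 / 2 \<le> t} z) \<partial>lborel)"
      unfolding layer[of "(norm z)\<^sup>2 / 2"]
      by (subst nn_integral_multc[symmetric], simp, subst nn_integral_cmult[symmetric])
         (auto intro!: nn_integral_cong split: split_indicator)
    finally show "ennreal (exp (- (norm z)\<^sup>2 / 2) / (2 * pi)) * indicator {z :: real^2. r \<le> norm z} z = \<dots>" .
  qed
  \<comment> \<open>Tonelli: all integrands are nonnegative, so joint measurability is the only
    obligation. Unfolding the indicator exposes the inequalities in \<open>z\<close> and
    \<open>t\<close> to \<open>measurable\<close>.\<close>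
  also have "\<dots> = (\<integral>\<^sup>+t. (\<integral>\<^sup>+z. ennreal (1 / (2 * pi)) *
       (ennreal (exp (- t)) * indicator {z :: real^2. r \<le> norm z \<and> (norm z)\<^sup>2 / 2 \<le> t} z) \<partial>lborel) \<partial>lborel)"
    unfolding indicator_def mem_Collect_eq by (rule lborel_pair.Fubini') measurable
  \<comment> \<open>For fixed \<open>t\<close> the set of \<open>z\<close> is the annulus between
    the radii \<open>r\<close> and \<open>sqrt (2 * t)\<close>. Its area is
    \<open>2 * pi * (t - c)\<close> if \<open>c \<le> t\<close>, and otherwise it is empty.\<close>
  also have "\<dots> = (\<integral>\<^sup>+t. ennreal (exp (- t) * (t - c)) * indicator {c..} t \<partial>lborel)"
  proof (intro nn_integral_cong)
    fix t :: real
    have "(\<integral>\<^sup>+z. ennreal (1 / (2 * pi)) *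
       (ennreal (exp (- t)) * indicator {z :: real^2. r \<le> norm z \<and> (norm z)\<^sup>2 / 2 \<le> t} z) \<partial>lborel)
      = ennreal (1 / (2 * pi)) * (ennreal (exp (- t)) *
         emeasure lborel {z :: real^2. r \<le> norm z \<and> (norm z)\<^sup>2 / 2 \<le> t})"
      by (simp add: nn_integral_cmult)
    also have "\<dots> = ennreal (exp (- t) * (t - c)) * indicator {c..} t"
    proof (cases "c \<le> t")
      case True
      have "(norm z)\<^sup>2 / 2 \<le> t \<longleftrightarrow> norm z \<le> sqrt (2 * t)" for z :: "real^2"
        using real_sqrt_le_iff[of "(norm z)\<^sup>2" "2 * t"] by (simp add: mult.commute)
      then have "{z :: real^2. r \<le> norm z \<and> (norm z)\<^sup>2 / 2 \<le> t}
        = {z. r \<le> norm z \<and> norm z \<le> sqrt (2 * t)}"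
        by simp
      moreover have "r \<le> sqrt (2 * t)"
        using True by (intro real_le_rsqrt) (simp add: c_def)
      moreover have "pi * ((sqrt (2 * t))\<^sup>2 - r\<^sup>2) = 2 * pi * (t - c)"
        using order_trans[OF c True] by (simp add: c_def field_simps)
      ultimately have "emeasure lborel {z :: real^2. r \<le> norm z \<and> (norm z)\<^sup>2 / 2 \<le> t}
        = ennreal (2 * pi * (t - c))"
        using emeasure_annulus[OF assms, of "sqrt (2 * t)"] by (simp only:)
      then show ?thesis
        using True by (simp add: ennreal_mult[symmetric])
    next
      case False
      have "\<not> (norm z)\<^sup>2 / 2 \<le> t" if "r \<le> norm z" for z :: "real^2"
        using False power_mono[OF that assms, of 2] by (auto simp: c_def)
      then have "{z :: real^2. r \<le> norm z \<and> (norm z)\<^sup>2 / 2 \<le> t} = {}"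
        by auto
      then have "emeasure lborel {z :: real^2. r \<le> norm z \<and> (norm z)\<^sup>2 / 2 \<le> t} = 0"
        by (simp only: emeasure_empty)
      with False show ?thesis by simp
    qed
    finally show "(\<integral>\<^sup>+z. ennreal (1 / (2 * pi)) *
       (ennreal (exp (- t)) * indicator {z :: real^2. r \<le> norm z \<and> (norm z)\<^sup>2 / 2 \<le> t} z) \<partial>lborel) = \<dots>" .
  qed
  \<comment> \<open>Integration by parts gives the antiderivative
    \<open>- exp (- t) * (t - c + 1)\<close> of \<open>exp (- t) * (t - c)\<close>.\<close>
  also have "\<dots> = ennreal (0 - - (exp (- c) * (c - c + 1)))"
  proof (rule nn_integral_FTC_atLeast[where F = "\<lambda>t. - (exp (- t) * (t - c + 1))"])
    show "((\<lambda>t. - (exp (- t) * (t - c + 1))) \<longlongrightarrow> 0) at_top"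
      by real_asymp
  qed (auto intro!: derivative_eq_intros simp: algebra_simps)
  finally show ?thesis
    by (simp add: c_def)
qed

lemma prob_space_std_gaussian_2: "prob_space (std_gaussian :: (real^2) measure)"
proof
  show "emeasure std_gaussian (space std_gaussian :: (real^2) set) = 1"
    using std_gaussian_2_tail[of 0] by (simp add: std_gaussian_2)
qed

text \<open>The complement of the tail event is the open disk, which lies in the closed one. Aiming
  at an inequality avoids measuring the boundary circle.\<close>

lemma std_gaussian_2_cball:
  assumes "0 \<le> r"
  shows "1 - exp (- r\<^sup>2 / 2) \<le> measure std_gaussian {z :: real^2. norm z \<le> r}"
proof -
  interpret prob_space "std_gaussian :: (real^2) measure"
    by (rule prob_space_std_gaussian_2)
  have [simp]: "sets (std_gaussian :: (real^2) measure) = sets borel"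
     "space (std_gaussian :: (real^2) measure) = UNIV"
    by (simp_all add: std_gaussian_2)
  have "1 - exp (- r\<^sup>2 / 2) = prob (UNIV - {z. r \<le> norm z})"
    using prob_compl[of "{z. r \<le> norm z}"] std_gaussian_2_tail[OF assms]
    by (simp add: measure_def)
  also have "\<dots> \<le> prob {z. norm z \<le> r}"
    by (intro finite_measure_mono) auto
  finally show ?thesis .
qed

section \<open>Whitening: from a known covariance to coverage\<close>

text \<open>With \<open>S = A ** transpose A\<close>, applying \<open>A\<close> to
  \<open>transpose A *v (matrix_inv S *v (A *v z))\<close> gives \<open>A *v z\<close>. Injectivity
  of \<open>A\<close> cancels the outer factor, and the other \<open>A\<close> moves across the
  inner product as a transpose.\<close>

lemma inverse_quadratic_form:
  fixes A :: "real^'n^'n"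
  assumes "invertible (A ** transpose A)"
  shows "(A *v z) \<bullet> (matrix_inv (A ** transpose A) *v (A *v z)) = z \<bullet> z"
proof -
  define S where "S = A ** transpose A"
  \<comment> \<open>\<open>matrix_inv\<close> is a Hilbert choice, so its defining property has to
    be recovered from invertibility.\<close>
  have S: "S ** matrix_inv S = mat 1"
    using assms unfolding S_def invertible_def matrix_inv_def by (rule someI2_ex) auto
  \<comment> \<open>\<open>transpose A ** matrix_inv S\<close> is a right inverse of the square
    matrix \<open>A\<close>.\<close>
  have "invertible A"
    using S unfolding S_def invertible_right_inverse by (metis matrix_mul_assoc)
  then have inj: "inj ((*v) A)"
    by (simp add: invertible_left_inverse matrix_left_invertible_injective)
  have "A *v (transpose A *v (matrix_inv S *v (A *v z))) = S *v (matrix_inv S *v (A *v z))"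
    unfolding S_def by (simp add: matrix_vector_mul_assoc matrix_mul_assoc)
  also have "\<dots> = A *v z"
    using S by (metis matrix_vector_mul_assoc matrix_vector_mul_lid)
  finally have "transpose A *v (matrix_inv S *v (A *v z)) = z"
    using inj by (simp add: inj_eq)
  then show ?thesis
    by (metis S_def dot_lmul_matrix inner_commute transpose_matrix_vector)
qed

text \<open>The radius \<open>sqrt (- 2 * ln \<alpha>)\<close> is the one at which the planar
  Gaussian tail \<open>exp (- r\<^sup>2 / 2)\<close> equals \<open>\<alpha>\<close>.\<close>

lemma confidence_region_CR_ellipse:
  fixes \<Sigma> :: "real^2^2"
  assumes inv: "invertible \<Sigma>" and \<alpha>: "0 < \<alpha>" "\<alpha> < 1"
  shows "confidence_region \<Sigma> (1 - \<alpha>) (CR_ellipse \<Sigma> \<alpha>)"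
  unfolding confidence_region_def
proof (intro allI impI conjI)
  fix H :: "real^2" and N
  assume "normal_law H \<Sigma> N"
  then obtain A :: "real^2^2" where A: "A ** transpose A = \<Sigma>"
    and N: "N = distr std_gaussian borel (\<lambda>z. H + A *v z)"
    unfolding normal_law_def by blast
  define E where "E = {f. H \<in> CR_ellipse \<Sigma> \<alpha> f}"
  have "E = {f. sqrt ((f - H) \<bullet> (matrix_inv \<Sigma> *v (f - H))) \<le> sqrt (- 2 * ln \<alpha>)}"
    by (simp add: E_def CR_ellipse_def)
  moreover have "closed \<dots>"
    by (intro closed_Collect_le continuous_intros linear_continuous_on_compose[where g = "\<lambda>x. matrix_inv \<Sigma> *v x"])
       simp
  ultimately have E: "E \<in> sets borel"
    by simp
  then show "{f. H \<in> CR_ellipse \<Sigma> \<alpha> f} \<in> sets N"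
    by (simp add: N E_def)
  have [simp]: "sets (std_gaussian :: (real^2) measure) = sets borel"
     "space (std_gaussian :: (real^2) measure) = UNIV"
    by (simp_all add: std_gaussian_2)
  have meas: "(\<lambda>z. H + A *v z) \<in> measurable std_gaussian borel"
    by (subst measurable_cong_sets[OF _ refl, of _ borel])
       (auto intro!: borel_measurable_continuous_onI continuous_intros)
  \<comment> \<open>Whatever factor \<open>A\<close> of the covariance is chosen, the event pulls
    back to the same centered disk.\<close>
  have "(\<lambda>z. H + A *v z) -` E = {z. norm z \<le> sqrt (- 2 * ln \<alpha>)}"
    using inverse_quadratic_form[of A] inv
    by (simp add: E_def CR_ellipse_def A norm_eq_sqrt_inner)
  then have "measure N E = measure std_gaussian {z :: real^2. norm z \<le> sqrt (- 2 * ln \<alpha>)}"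
    unfolding N using E meas by (simp add: measure_distr)
  moreover have "1 - \<alpha> \<le> \<dots>"
    using std_gaussian_2_cball[of "sqrt (- 2 * ln \<alpha>)"] \<alpha> by (simp add: ln_le_zero_iff)
  ultimately show "1 - \<alpha> \<le> measure N {f. H \<in> CR_ellipse \<Sigma> \<alpha> f}"
    by (simp add: E_def)
qed

text \<open>Passes from laws to random vectors: the event on \<open>\<Omega>\<close> is the preimage
  under \<open>F\<close> of an event whose measurability is part of
  \<open>confidence_region\<close>.\<close>

lemma confidence_region_normal_vector:
  assumes CR: "confidence_region \<Sigma> p CR" and F: "normal_vector \<Omega> F H \<Sigma>"
  shows "p \<le> measure \<Omega> {\<omega> \<in> space \<Omega>. H \<in> CR (F \<omega>)}"
proof -
  have "normal_law H \<Sigma> (distr \<Omega> borel F)" and [measurable]: "F \<in> borel_measurable \<Omega>"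
    using F by (auto simp: normal_vector_def)
  with CR have "{f. H \<in> CR f} \<in> sets borel" "p \<le> measure (distr \<Omega> borel F) {f. H \<in> CR f}"
    by (force simp: confidence_region_def)+
  moreover have "F -` {f. H \<in> CR f} \<inter> space \<Omega> = {\<omega> \<in> space \<Omega>. H \<in> CR (F \<omega>)}"
    by auto
  ultimately show ?thesis
    by (simp add: measure_distr)
qed

section \<open>Integration lemmas\<close>

text \<open>\<open>U - C\<close> is open and null, whereas a nonempty open set contains a ball of
  positive measure. This turns almost-everywhere vanishing into vanishing at every point.\<close>

lemma AE_lborel_open_imp_closed:
  fixes U C :: "'a::euclidean_space set"
  assumes "open U" "closed C" and AE: "AE x in lborel. x \<in> U \<longrightarrow> x \<in> C"
  shows "U \<subseteq> C"
proof (rule ccontr)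
  assume "\<not> U \<subseteq> C"
  then obtain x where "x \<in> U - C"
    by auto
  moreover have "open (U - C)"
    using assms by (simp add: open_Diff)
  ultimately obtain e where e: "0 < e" "ball x e \<subseteq> U - C"
    by (meson open_contains_ball)
  from AE have "AE y in lborel. y \<notin> ball x e"
    by (rule eventually_mono) (use e in blast)
  then have "emeasure lborel (ball x e) = 0"
    by (simp add: AE_iff_measurable[OF _ refl] ball_def)
  then show False
    using e unit_ball_vol_pos[of "real DIM('a)"] by (simp add: emeasure_ball del: unit_ball_vol_pos)
qed

lemma finite_measure_density_indicator:
  assumes "compact A"
  shows "finite_measure (density lborel (\<lambda>x :: 'a::euclidean_space. ennreal (indicator A x)))"
proof
  have "A \<in> sets borel"
    using assms by (simp add: borel_compact)
  then have "emeasure (density lborel (\<lambda>x. ennreal (indicator A x))) (space lborel) = emeasure lborel A"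
    by (simp add: emeasure_density ennreal_indicator)
  then show "emeasure (density lborel (\<lambda>x. ennreal (indicator A x)))
      (space (density lborel (\<lambda>x. ennreal (indicator A x)))) \<noteq> \<infinity>"
    using emeasure_compact_finite[OF assms] by simp
qed

text \<open>Fubini is used twice: in \<open>(y, p)\<close> for fixed \<open>x\<close>, then in
  \<open>(x, p)\<close> with the inner integral \<open>G\<close> as a bounded factor. Boundedness on
  finite measures supplies integrability both times. It is the source of the Gram structure of the
  covariance.\<close>

lemma bilinear_Fubini:
  fixes f g :: "'a \<Rightarrow> 'b \<Rightarrow> real"
  assumes "finite_measure M" "finite_measure N"
    and f [measurable]: "case_prod f \<in> borel_measurable (M \<Otimes>\<^sub>M N)"
    and g [measurable]: "case_prod g \<in> borel_measurable (M \<Otimes>\<^sub>M N)"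
    and bf: "\<And>x p. \<bar>f x p\<bar> \<le> K" and bg: "\<And>x p. \<bar>g x p\<bar> \<le> L"
  shows "(\<integral>x. (\<integral>y. (\<integral>p. f x p * g y p \<partial>N) \<partial>M) \<partial>M) = (\<integral>p. (\<integral>x. f x p \<partial>M) * (\<integral>y. g y p \<partial>M) \<partial>N)"
proof -
  interpret M: finite_measure M by fact
  interpret N: finite_measure N by fact
  interpret MN: pair_sigma_finite M N ..
  interpret P: finite_measure "M \<Otimes>\<^sub>M N"
    by (rule finite_measure_pair_measure) fact+
  define G where "G p = (\<integral>y. g y p \<partial>M)" for p
  have [measurable]: "G \<in> borel_measurable N"
    unfolding G_def by measurable
  have K: "0 \<le> K" and L: "0 \<le> L"
    using abs_ge_zero[THEN order_trans, OF bf] abs_ge_zero[THEN order_trans, OF bg] by auto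
  have bG: "\<bar>G p\<bar> \<le> L * measure M (space M)" if p: "p \<in> space N" for p
  proof -
    have "integrable M (\<lambda>y. g y p)"
      using p bg by (intro M.integrable_const_bound[where B = L]) auto
    then have "norm (G p) \<le> (\<integral>y. L \<partial>M)"
      unfolding G_def using bg
      by (intro order_trans[OF integral_norm_bound] integral_mono) auto
    then show ?thesis by (simp add: mult.commute)
  qed
  have "(\<integral>x. (\<integral>y. (\<integral>p. f x p * g y p \<partial>N) \<partial>M) \<partial>M) = (\<integral>x. (\<integral>p. f x p * G p \<partial>N) \<partial>M)"
  proof (intro Bochner_Integration.integral_cong refl)
    fix x assume [measurable]: "x \<in> space M"
    have "integrable (M \<Otimes>\<^sub>M N) (\<lambda>(y, p). f x p * g y p)"
      by (rule P.integrable_const_bound[where B = "K * L"])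
         (auto simp: abs_mult intro!: AE_I2 mult_mono bf bg K L)
    from MN.Fubini_integral[OF this]
    show "(\<integral>y. (\<integral>p. f x p * g y p \<partial>N) \<partial>M) = (\<integral>p. f x p * G p \<partial>N)"
      by (simp add: G_def)
  qed
  also have "\<dots> = (\<integral>p. (\<integral>x. f x p * G p \<partial>M) \<partial>N)"
    by (rule MN.Fubini_integral[symmetric], rule P.integrable_const_bound[where B = "K * (L * measure M (space M))"])
       (auto simp: abs_mult space_pair_measure intro!: AE_I2 mult_mono bf bG K L)
  finally show ?thesis
    by (simp add: G_def)
qed

lemma integrable_compact_support:
  fixes f :: "real \<Rightarrow> real"
  assumes "continuous_on UNIV f" and "\<And>t. R < \<bar>t\<bar> \<Longrightarrow> f t = 0"
  shows "integrable lborel f"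
proof -
  have "integrable lborel (\<lambda>x. indicator {-R..R} x *\<^sub>R f x)"
    using assms by (intro borel_integrable_compact) (auto intro: continuous_on_subset)
  also have "(\<lambda>x. indicator {-R..R} x *\<^sub>R f x) = f"
    using assms(2) by (force split: split_indicator)
  finally show ?thesis .
qed

lemma integral_deriv_compact_support:
  fixes F f :: "real \<Rightarrow> real"
  assumes "\<And>t. (F has_real_derivative f t) (at t)" "continuous_on UNIV f"
    and F: "\<And>t. R < \<bar>t\<bar> \<Longrightarrow> F t = 0" and f: "\<And>t. R < \<bar>t\<bar> \<Longrightarrow> f t = 0"
  shows "(\<integral>t. f t \<partial>lborel) = 0"
proof -
  \<comment> \<open>The endpoints must satisfy the strict inequality
    \<open>R < \<bar>t\<bar>\<close>, hence the \<open>+ 1\<close>. The absolute value keeps the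
    interval nonempty for negative \<open>R\<close>.\<close>
  define S where "S = \<bar>R\<bar> + 1"
  have "(\<integral>t. indicator {-S..S} t *\<^sub>R f t \<partial>lborel) = F S - F (- S)"
    using assms(1,2)
    by (intro integral_FTC_Icc) (auto simp: S_def has_real_derivative_iff_has_vector_derivative[symmetric]
        intro: has_field_derivative_at_within continuous_on_subset)
  also have "(\<lambda>t. indicator {-S..S} t *\<^sub>R f t) = f"
    using f by (force simp: S_def split: split_indicator)
  finally show ?thesis
    using F by (simp add: S_def)
qed

text \<open>Cut the line into unit intervals and translate each to \<open>{0..<1}\<close>: the
  integral of \<open>\<phi>\<close> becomes the integral over one period of the sum of its integer
  translates, which is 1.\<close>

lemma partition_of_unity_integral:
  fixes \<phi> :: "real \<Rightarrow> real"
  assumes cont: "continuous_on UNIV \<phi>" and supp: "\<And>t. R < \<bar>t\<bar> \<Longrightarrow> \<phi> t = 0"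
    and sum: "\<And>t. ((\<lambda>k::int. \<phi> (t - of_int k)) has_sum 1) UNIV"
  shows "(\<integral>t. \<phi> t \<partial>lborel) = 1"
proof -
  \<comment> \<open>Large enough that for \<open>t\<close> in \<open>{0..<1}\<close> every translate
    with index outside \<open>{-N..N}\<close> vanishes at \<open>t\<close>, so the infinite sum is
    finite.\<close>
  define N where "N = \<lceil>\<bar>R\<bar>\<rceil> + 1"
  have N: "\<bar>R\<bar> + 1 \<le> of_int N"
    by (simp add: N_def)
  have [measurable]: "\<phi> \<in> borel_measurable borel"
    using cont by (rule borel_measurable_continuous_onI)
  have int: "integrable lborel \<phi>"
    using cont supp by (rule integrable_compact_support)
  have unity: "(\<Sum>k\<in>{-N..N}. \<phi> (t - of_int k)) = 1" if "t \<in> {0..<1}" for t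
  proof -
    have "\<phi> (t - of_int k) = 0" if "k \<notin> {-N..N}" for k
    proof -
      have "k \<le> - N - 1 \<or> N + 1 \<le> k"
        using that by auto
      then have "real_of_int k \<le> - of_int N - 1 \<or> of_int N + 1 \<le> real_of_int k"
        by linarith
      then show ?thesis
        using N \<open>t \<in> _\<close> by (intro supp) auto
    qed
    then have "((\<lambda>k::int. \<phi> (t - of_int k)) has_sum (\<Sum>k\<in>{-N..N}. \<phi> (t - of_int k))) UNIV"
      by (intro has_sum_finite_neutralI[where B = "{-N..N}"]) auto
    with sum show ?thesis
      by (rule has_sum_unique[symmetric])
  qed
  have pieces: "(\<Sum>k\<in>{-N..N}. indicator {0..<1} (u + of_int k) * \<phi> u) = \<phi> u" for u
  proof (cases "\<bar>u\<bar> \<le> R")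
    case True
    \<comment> \<open>Half-open intervals tile the line, so each \<open>u\<close> lies in exactly
      one piece.\<close>
    have ind: "indicator {0..<1} (u + of_int k) = (if k = - \<lfloor>u\<rfloor> then 1 else 0 :: real)" for k
      by (auto simp: indicator_def) linarith+
    have "- \<lfloor>u\<rfloor> \<in> {-N..N}"
      using True N by (simp add: floor_le_iff le_floor_iff) linarith
    then show ?thesis
      by (simp add: ind if_distrib[of "\<lambda>x. x * _"] cong: if_cong)
  qed (simp add: supp)
  have int': "integrable lborel (\<lambda>u. indicator {0..<1} (u + of_int k) * \<phi> u)" for k
    by (rule Bochner_Integration.integrable_bound[OF int]) (auto split: split_indicator)
  have "(\<integral>u. \<phi> u \<partial>lborel) = (\<Sum>k\<in>{-N..N}. \<integral>u. indicator {0..<1} (u + of_int k) * \<phi> u \<partial>lborel)"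
    by (subst pieces[symmetric], subst Bochner_Integration.integral_sum) (auto simp: int')
  also have "\<dots> = (\<Sum>k\<in>{-N..N}. \<integral>t. indicator {0..<1} t * \<phi> (t - of_int k) \<partial>lborel)"
  proof (intro sum.cong refl)
    fix k
    show "(\<integral>u. indicator {0..<1} (u + of_int k) * \<phi> u \<partial>lborel)
        = (\<integral>t. indicator {0..<1} t * \<phi> (t - of_int k) \<partial>lborel)"
      by (subst lborel_integral_real_affine[of 1 _ "- of_int k"]) simp_all
  qed
  also have "\<dots> = (\<integral>t. (\<Sum>k\<in>{-N..N}. indicator {0..<1} t * \<phi> (t - of_int k)) \<partial>lborel)"
  proof (rule Bochner_Integration.integral_sum[symmetric])
    fix k
    have "integrable lborel (\<lambda>t. \<phi> (- of_int k + 1 * t))"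
      using int by (subst lborel_integrable_real_affine_iff) auto
    then show "integrable lborel (\<lambda>t. indicator {0..<1} t * \<phi> (t - of_int k))"
      by (rule Bochner_Integration.integrable_bound) (auto split: split_indicator)
  qed
  also have "\<dots> = (\<integral>t. indicator {0..<1::real} t \<partial>lborel)"
    by (intro Bochner_Integration.integral_cong) (auto simp: unity simp flip: sum_distrib_left simp del: atLeastAtMost_iff split: split_indicator)
  finally show ?thesis
    by simp
qed

text \<open>Integration by parts: the derivative of \<open>s\<^sup>2 * \<phi> (d + s)\<close> has
  integral 0. Substituting \<open>u = d + s\<close> in the remaining first moment leaves
  \<open>d\<close> multiplied by the total mass of \<open>\<phi>\<close>.\<close>

lemma second_moment_deriv_translate:
  fixes \<phi> \<psi> :: "real \<Rightarrow> real"
  assumes der: "\<And>t. (\<phi> has_real_derivative \<psi> t) (at t)" and cont: "continuous_on UNIV \<psi>"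
    and supp: "\<And>t. R < \<bar>t\<bar> \<Longrightarrow> \<phi> t = 0" "\<And>t. R < \<bar>t\<bar> \<Longrightarrow> \<psi> t = 0"
    and one: "(\<integral>t. \<phi> t \<partial>lborel) = 1"
  shows "(\<integral>s. s\<^sup>2 * \<psi> (d + s) \<partial>lborel) = 2 * d - 2 * (\<integral>u. u * \<phi> u \<partial>lborel)"
proof -
  have c\<phi>: "continuous_on UNIV \<phi>"
    using der by (auto intro!: continuous_at_imp_continuous_on DERIV_isCont)
  have [continuous_intros]: "continuous_on UNIV (\<lambda>s. \<psi> (d + s))" "continuous_on UNIV (\<lambda>s. \<phi> (d + s))"
    by (rule continuous_on_compose2[OF cont] continuous_on_compose2[OF c\<phi>]; auto intro!: continuous_intros)+
  have ints: "integrable lborel (\<lambda>s. s\<^sup>2 * \<psi> (d + s))" "integrable lborel (\<lambda>s. 2 * s * \<phi> (d + s))"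
    by (rule integrable_compact_support[where R = "R + \<bar>d\<bar>"];
        auto intro!: continuous_intros simp: supp)+
  have "(\<integral>s. 2 * s * \<phi> (d + s) + s\<^sup>2 * \<psi> (d + s) \<partial>lborel) = 0"
  proof (rule integral_deriv_compact_support[where R = "R + \<bar>d\<bar>" and F = "\<lambda>s. s\<^sup>2 * \<phi> (d + s)"])
    show "((\<lambda>s. s\<^sup>2 * \<phi> (d + s)) has_real_derivative 2 * s * \<phi> (d + s) + s\<^sup>2 * \<psi> (d + s)) (at s)" for s
      by (auto intro!: derivative_eq_intros DERIV_chain2[OF der])
  qed (auto intro!: continuous_intros simp: supp)
  then have "(\<integral>s. s\<^sup>2 * \<psi> (d + s) \<partial>lborel) = - (\<integral>s. 2 * s * \<phi> (d + s) \<partial>lborel)"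
    using ints by simp
  also have "(\<integral>s. 2 * s * \<phi> (d + s) \<partial>lborel) = (\<integral>u. 2 * (u - d) * \<phi> u \<partial>lborel)"
    by (subst lborel_integral_real_affine[of 1 "\<lambda>u. 2 * (u - d) * \<phi> u" d]) simp_all
  also have "\<dots> = (\<integral>u. 2 * (u * \<phi> u) - 2 * d * \<phi> u \<partial>lborel)"
    by (simp add: algebra_simps)
  also have "\<dots> = 2 * (\<integral>u. u * \<phi> u \<partial>lborel) - 2 * d * (\<integral>u. \<phi> u \<partial>lborel)"
    using c\<phi> supp
    by (subst Bochner_Integration.integral_diff)
       (auto intro!: integrable_compact_support[where R = R] continuous_intros)
  finally show ?thesis
    by (simp add: one)
qed

section \<open>Unit directions and reflection symmetry\<close>

lemma inner_dir: "v \<bullet> dir a = v $ 1 * cos a + v $ 2 * sin a"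
  by (simp add: dir_def inner_vec_def sum_2)

lemma norm_dir: "norm (dir a) = 1"
  by (simp add: norm_eq_sqrt_inner inner_dir) (simp add: dir_def power2_eq_square[symmetric])

lemma continuous_on_dir: "continuous_on S dir"
proof -
  have "dir = (\<lambda>a. \<chi> i. if i = 1 then cos a else sin a)"
    by (auto simp: dir_def vec_eq_iff forall_2)
  moreover have "continuous_on S (\<lambda>a. (\<chi> i. if i = 1 then cos a else sin a) :: real^2)"
  proof (rule continuous_on_vec_lambda)
    show "continuous_on S (\<lambda>a. if i = 1 then cos a else sin a)" for i :: 2
      by (cases "i = 1") (auto intro!: continuous_intros)
  qed
  ultimately show ?thesis
    by (simp only:)
qed

text \<open>Two directions at angles less than \<open>pi\<close> apart are linearly independent,
  with determinant \<open>sin (t - s)\<close>. Cramer's rule then yields both components of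
  \<open>w\<close>.\<close>

lemma inner_dir_eq_0_on_interval:
  fixes w :: "real^2"
  assumes "a < b" and zero: "\<And>t. a < t \<Longrightarrow> t < b \<Longrightarrow> w \<bullet> dir t = 0"
  shows "w = 0"
proof -
  \<comment> \<open>The minimum keeps both angles inside the interval and at most \<open>1/2\<close>
    apart, below \<open>pi\<close>.\<close>
  define s t where "s = a + min 1 ((b - a) / 2) / 2" and "t = a + min 1 ((b - a) / 2)"
  have st: "a < s" "s < t" "t < b" "t - s < pi"
    using assms(1) pi_gt3 by (auto simp: s_def t_def min_def field_simps)
  have s: "w $ 1 * cos s + w $ 2 * sin s = 0" and t: "w $ 1 * cos t + w $ 2 * sin t = 0"
    using zero[of s] zero[of t] st by (auto simp: inner_dir)
  have "sin (t - s) > 0"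
    using st by (intro sin_gt_zero) auto
  moreover have "w $ 1 * sin (t - s) = (w $ 1 * cos s + w $ 2 * sin s) * sin t - (w $ 1 * cos t + w $ 2 * sin t) * sin s"
    "w $ 2 * sin (t - s) = (w $ 1 * cos t + w $ 2 * sin t) * cos s - (w $ 1 * cos s + w $ 2 * sin s) * cos t"
    by (simp_all add: sin_diff algebra_simps)
  ultimately show ?thesis
    unfolding s t by (auto simp: vec_eq_iff forall_2)
qed

text \<open>Reflection preserves Lebesgue measure, so the integral equals its own negative. If
  \<open>f\<close> is not integrable, the default value 0 agrees with the claim.\<close>

lemma integral_lborel_odd:
  fixes f :: "'a::euclidean_space \<Rightarrow> real"
  assumes [measurable]: "f \<in> borel_measurable borel" and odd: "\<And>x. f (- x) = - f x"
  shows "(\<integral>x. f x \<partial>lborel) = 0"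
proof -
  have "(lborel :: 'a measure) = distr lborel borel uminus"
    using lborel_affine[of "- 1" "0 :: 'a"] by (simp add: density_1)
  then have "(\<integral>x. f x \<partial>lborel) = (\<integral>x. f x \<partial>distr lborel borel uminus)"
    by simp
  also have "\<dots> = (\<integral>x. f (- x) \<partial>lborel)"
    by (subst integral_distr) auto
  finally have "(\<integral>x. f x \<partial>lborel) = (\<integral>x. f (- x) \<partial>lborel)" .
  then show ?thesis
    by (simp add: odd)
qed

section \<open>Invertibility of the covariance matrix\<close>

text \<open>Collects the analytic facts behind invertibility. \<open>cov_fun\<close> sees
  \<open>\<sigma>\<close> only along the curve \<open>p = dir a \<bullet> x0\<close>, so continuity
  is required of that function of the angle.\<close>

locale edge_covariance =
  fixes \<rho> \<kappa> R :: real and \<sigma> :: "real \<Rightarrow> real \<Rightarrow> real" and \<phi> :: "real \<Rightarrow> real" and x0 :: "real^2"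
  assumes \<rho>: "0 < \<rho>" and \<kappa>: "0 < \<kappa>"
    and \<sigma>_cont: "continuous_on {0..2 * pi} (\<lambda>a. \<sigma> a (dir a \<bullet> x0))"
    and \<phi>_deriv: "\<And>t. (\<phi> has_real_derivative deriv \<phi> t) (at t)"
    and cont: "continuous_on UNIV (deriv \<phi>)"
    and supp: "\<And>t. R < \<bar>t\<bar> \<Longrightarrow> \<phi> t = 0" "\<And>t. R < \<bar>t\<bar> \<Longrightarrow> deriv \<phi> t = 0"
    and \<phi>_int: "(\<integral>t. \<phi> t \<partial>lborel) = 1"
begin

abbreviation "\<psi> \<equiv> deriv \<phi>"

text \<open>Encoded as a density, as are \<open>angles\<close> and \<open>shifts\<close>, so that
  the underlying space stays \<open>UNIV\<close> with the Borel sets while the total mass is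
  finite.\<close>

definition "disk = density lborel (\<lambda>x :: real^2. ennreal (indicator (cball 0 \<rho>) x))"

definition "weight a = indicator {0..2 * pi} a * (\<sigma> a (dir a \<bullet> x0))\<^sup>2"

definition "angles = density lborel (\<lambda>a. ennreal (weight a))"

text \<open>For \<open>x\<close> in the disk,
  \<open>\<bar>x \<bullet> dir a\<bar> \<le> \<rho>\<close>, so
  \<open>\<psi> (x \<bullet> dir a + s)\<close> vanishes outside this interval.\<close>

definition "shifts = density lborel (\<lambda>s. ennreal (indicator {- (R + \<rho>)..R + \<rho>} s))"

text \<open>The indicator is redundant under \<open>disk\<close>; it makes the kernel globally bounded for Fubini.\<close>

definition kernel :: "real^2 \<Rightarrow> real^2 \<Rightarrow> real \<times> real \<Rightarrow> real" where
  "kernel v x p = indicator (cball 0 \<rho>) x * (v \<bullet> x) * \<psi> (x \<bullet> dir (fst p) + snd p)"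

definition profile :: "real^2 \<Rightarrow> real \<times> real \<Rightarrow> real" where
  "profile v p = (\<integral>x. kernel v x p \<partial>disk)"

section \<open>Measurability, bounds and finiteness\<close>

lemma sets_simps [simp, measurable_cong]:
  "sets disk = sets borel" "sets angles = sets borel" "sets shifts = sets borel"
  by (simp_all add: disk_def angles_def shifts_def)

lemma space_simps [simp]: "space disk = UNIV" "space angles = UNIV" "space shifts = UNIV"
  by (simp_all add: disk_def angles_def shifts_def)

lemma measurable_dir [measurable]: "dir \<in> borel_measurable borel"
  by (intro borel_measurable_continuous_onI continuous_on_dir)

lemma measurable_disk_set [measurable]: "cball (0 :: real^2) \<rho> \<in> sets borel"
  by simp

lemma measurable_\<psi> [measurable]: "\<psi> \<in> borel_measurable borel"
  using cont by (rule borel_measurable_continuous_onI)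

lemma measurable_weight [measurable]: "weight \<in> borel_measurable borel"
  using borel_measurable_continuous_on_indicator[OF _ continuous_on_power[OF \<sigma>_cont, of 2]]
  by (simp add: weight_def[abs_def])

lemma weight_nonneg [simp]: "0 \<le> weight a"
  by (simp add: weight_def)

lemma bounded_\<psi>: obtains L where "0 \<le> L" "\<And>t. \<bar>\<psi> t\<bar> \<le> L"
proof -
  have "compact (\<psi> ` {-R..R})"
    using cont by (intro compact_continuous_image) (auto intro: continuous_on_subset)
  then obtain L where L: "\<And>t. t \<in> {-R..R} \<Longrightarrow> \<bar>\<psi> t\<bar> \<le> L"
    using compact_imp_bounded bounded_iff by (metis image_eqI real_norm_def)
  \<comment> \<open>\<open>\<bar>L\<bar>\<close> instead of \<open>L\<close>: if
    \<open>{-R..R}\<close> is empty, \<open>L\<close> may be negative.\<close>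
  have "\<bar>\<psi> t\<bar> \<le> \<bar>L\<bar>" for t
  proof (cases "R < \<bar>t\<bar>")
    case False
    then have "t \<in> {-R..R}"
      by auto
    then show ?thesis
      by (intro order_trans[OF L abs_ge_self])
  qed (simp add: supp)
  then show ?thesis
    by (intro that[of "\<bar>L\<bar>"]) auto
qed

sublocale disk: finite_measure disk
  unfolding disk_def by (rule finite_measure_density_indicator) simp

sublocale shifts: finite_measure shifts
  unfolding shifts_def by (rule finite_measure_density_indicator) simp

sublocale angles: finite_measure angles
proof
  have "integrable lborel (\<lambda>a. indicator {0..2 * pi} a *\<^sub>R (\<sigma> a (dir a \<bullet> x0))\<^sup>2)"
    using \<sigma>_cont by (intro borel_integrable_compact) (auto intro!: continuous_intros)
  then have "integrable lborel weight"
    by (simp add: weight_def[abs_def])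
  then show "emeasure angles (space angles) \<noteq> \<infinity>"
    by (simp add: angles_def emeasure_density nn_integral_eq_integral)
qed

sublocale angles_shifts: pair_sigma_finite angles shifts ..

sublocale disk_shifts: pair_sigma_finite disk shifts ..

lemma finite_angles_shifts: "finite_measure (angles \<Otimes>\<^sub>M shifts)"
  by (rule finite_measure_pair_measure) unfold_locales

lemma measurable_kernel [measurable]: "case_prod (kernel v) \<in> borel_measurable (disk \<Otimes>\<^sub>M (angles \<Otimes>\<^sub>M shifts))"
  unfolding kernel_def[abs_def] by measurable

lemma measurable_profile [measurable]: "profile v \<in> borel_measurable (angles \<Otimes>\<^sub>M shifts)"
  unfolding profile_def[abs_def] by measurable

lemma bounded_kernel: obtains L where "\<And>x p. \<bar>kernel v x p\<bar> \<le> L"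
proof -
  obtain L where L: "0 \<le> L" "\<And>t. \<bar>\<psi> t\<bar> \<le> L"
    using bounded_\<psi> by blast
  have "\<bar>kernel v x p\<bar> \<le> norm v * \<rho> * L" for x p
  proof -
    have "\<bar>indicator (cball 0 \<rho>) x * (v \<bullet> x)\<bar> \<le> norm v * \<rho>"
      using order_trans[OF Cauchy_Schwarz_ineq2 mult_left_mono[OF _ norm_ge_zero]] \<rho>
      by (auto split: split_indicator)
    then show ?thesis
      using L \<rho> unfolding kernel_def by (subst abs_mult, intro mult_mono) auto
  qed
  then show ?thesis
    by (rule that)
qed

lemma integrable_kernel: "integrable disk (\<lambda>x. kernel v x p)"
proof -
  obtain L where L: "\<And>x p. \<bar>kernel v x p\<bar> \<le> L"
    using bounded_kernel[of v] by blast
  have "(\<lambda>x. kernel v x p) \<in> borel_measurable disk"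
    unfolding kernel_def[abs_def] by measurable
  with L show ?thesis
    by (intro disk.integrable_const_bound[where B = L]) auto
qed

lemma bounded_profile: obtains L where "0 \<le> L" "\<And>p. \<bar>profile v p\<bar> \<le> L"
proof -
  obtain L where L: "\<And>x p. \<bar>kernel v x p\<bar> \<le> L"
    using bounded_kernel[of v] by blast
  have bound: "\<bar>profile v p\<bar> \<le> (\<integral>x. L \<partial>disk)" for p
  proof -
    have "norm (profile v p) \<le> (\<integral>x. norm (kernel v x p) \<partial>disk)"
      unfolding profile_def by (rule integral_norm_bound)
    also have "\<dots> \<le> (\<integral>x. L \<partial>disk)"
      using L by (intro integral_mono) (auto simp: integrable_kernel)
    finally show ?thesis
      by simp
  qed
  show ?thesis
    using that[OF order_trans[OF abs_ge_zero bound] bound] .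
qed

lemma profile_linear: "profile v p = (\<Sum>i\<in>UNIV. v $ i * profile (axis i 1) p)"
proof -
  have "kernel v x p = (\<Sum>i\<in>UNIV. v $ i * kernel (axis i 1) x p)" for x
    by (simp add: kernel_def inner_vec_def[of v x] inner_axis' sum_distrib_left sum_distrib_right mult_ac)
  then show ?thesis
    by (simp add: profile_def integrable_kernel Bochner_Integration.integral_sum)
qed

lemma integrable_profile_mult: "integrable (angles \<Otimes>\<^sub>M shifts) (\<lambda>p. profile v p * profile w p)"
proof -
  interpret finite_measure "angles \<Otimes>\<^sub>M shifts" by (rule finite_angles_shifts)
  obtain L where "0 \<le> L" "\<And>p. \<bar>profile v p\<bar> \<le> L" using bounded_profile by blast
  moreover obtain L' where "0 \<le> L'" "\<And>p. \<bar>profile w p\<bar> \<le> L'" using bounded_profile by blast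
  ultimately show ?thesis
    by (intro integrable_const_bound[where B = "L * L'"]) (auto simp: abs_mult intro!: mult_mono)
qed

lemma inner_dir_bound: "x \<in> cball 0 \<rho> \<Longrightarrow> \<bar>x \<bullet> dir a\<bar> \<le> \<rho>"
  using Cauchy_Schwarz_ineq2[of x "dir a"] by (simp add: norm_dir)

lemma integral_shifts:
  fixes f :: "real \<Rightarrow> real"
  assumes [measurable]: "f \<in> borel_measurable borel" and "\<And>s. R + \<rho> < \<bar>s\<bar> \<Longrightarrow> f s = 0"
  shows "(\<integral>s. f s \<partial>shifts) = (\<integral>s. f s \<partial>lborel)"
proof -
  have "(\<integral>s. f s \<partial>shifts) = (\<integral>s. indicator {- (R + \<rho>)..R + \<rho>} s *\<^sub>R f s \<partial>lborel)"
    unfolding shifts_def by (rule integral_density) auto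
  also have "(\<lambda>s. indicator {- (R + \<rho>)..R + \<rho>} s *\<^sub>R f s) = f"
    using assms(2) by (force split: split_indicator)
  finally show ?thesis .
qed

section \<open>The covariance as a Gram matrix of profiles\<close>

text \<open>Translating the correlation variable by \<open>y \<bullet> dir a\<close> separates the
  points: one factor depends on \<open>x\<close>, the other on \<open>y\<close>. The factor in
  \<open>x\<close> confines \<open>s\<close> to the range of \<open>shifts\<close>.\<close>

lemma cross_corr_eq:
  assumes x: "x \<in> cball 0 \<rho>"
  shows "cross_corr \<psi> \<psi> (dir a \<bullet> (x - y)) = (\<integral>s. \<psi> (x \<bullet> dir a + s) * \<psi> (y \<bullet> dir a + s) \<partial>shifts)"
proof -
  have "cross_corr \<psi> \<psi> (dir a \<bullet> (x - y)) = (\<integral>s. \<psi> (x \<bullet> dir a + s) * \<psi> (y \<bullet> dir a + s) \<partial>lborel)"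
    unfolding cross_corr_def
    by (subst lborel_integral_real_affine[of 1 _ "y \<bullet> dir a"])
       (simp_all add: inner_diff_right inner_commute[of "dir a"] algebra_simps)
  also have "\<dots> = (\<integral>s. \<psi> (x \<bullet> dir a + s) * \<psi> (y \<bullet> dir a + s) \<partial>shifts)"
    using inner_dir_bound[OF x, of a] by (intro integral_shifts[symmetric]) (auto simp: supp)
  finally show ?thesis .
qed

lemma cov_fun_eq:
  assumes x: "x \<in> cball 0 \<rho>"
  shows "cov_fun \<kappa> \<sigma> \<phi> x0 (x - y) = (\<kappa> / (4 * pi))\<^sup>2 *
    (\<integral>p. \<psi> (x \<bullet> dir (fst p) + snd p) * \<psi> (y \<bullet> dir (fst p) + snd p) \<partial>(angles \<Otimes>\<^sub>M shifts))"
proof -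
  define c where "c a = (\<integral>s. \<psi> (x \<bullet> dir a + s) * \<psi> (y \<bullet> dir a + s) \<partial>shifts)" for a
  have [measurable]: "c \<in> borel_measurable borel"
    unfolding c_def[abs_def] by measurable
  have "(LINT a:{0..2 * pi}|lborel. (\<sigma> a (dir a \<bullet> x0))\<^sup>2 * cross_corr \<psi> \<psi> (dir a \<bullet> (x - y)))
      = (\<integral>a. weight a *\<^sub>R c a \<partial>lborel)"
    by (simp add: set_lebesgue_integral_def weight_def cross_corr_eq[OF x] c_def mult.assoc)
  also have "\<dots> = (\<integral>a. c a \<partial>angles)"
    unfolding angles_def by (rule integral_density[symmetric]) auto
  also have "\<dots> = (\<integral>p. \<psi> (x \<bullet> dir (fst p) + snd p) * \<psi> (y \<bullet> dir (fst p) + snd p) \<partial>(angles \<Otimes>\<^sub>M shifts))"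
  proof -
    interpret finite_measure "angles \<Otimes>\<^sub>M shifts" by (rule finite_angles_shifts)
    obtain L where "0 \<le> L" "\<And>t. \<bar>\<psi> t\<bar> \<le> L"
      using bounded_\<psi> by blast
    then have "integrable (angles \<Otimes>\<^sub>M shifts) (\<lambda>p. \<psi> (x \<bullet> dir (fst p) + snd p) * \<psi> (y \<bullet> dir (fst p) + snd p))"
      by (intro integrable_const_bound[where B = "L * L"]) (auto simp: abs_mult intro!: mult_mono)
    from angles_shifts.integral_fst'[OF this] show ?thesis
      by (simp add: c_def)
  qed
  finally show ?thesis
    by (simp add: cov_fun_def)
qed

lemma set_integral_disk:
  fixes f :: "real^2 \<Rightarrow> real"
  assumes [measurable]: "f \<in> borel_measurable borel"
  shows "(LINT x:cball 0 \<rho>|lborel. f x) = (\<integral>x. f x \<partial>disk)"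
  unfolding disk_def set_lebesgue_integral_def by (rule integral_density[symmetric]) auto

text \<open>Integrating the separated product over \<open>x\<close> and \<open>y\<close> with
  \<open>bilinear_Fubini\<close> gives a Gram matrix: each entry is an inner product of two
  profiles.\<close>

lemma cov_matrix_entry:
  "cov_matrix \<rho> \<kappa> \<sigma> \<phi> x0 $ i $ j = (\<kappa> / (4 * pi))\<^sup>2 *
     (\<integral>p. profile (axis i 1) p * profile (axis j 1) p \<partial>(angles \<Otimes>\<^sub>M shifts))"
proof -
  interpret P: finite_measure "angles \<Otimes>\<^sub>M shifts" by (rule finite_angles_shifts)
  define J where "J x y = (\<integral>p. kernel (axis i 1) x p * kernel (axis j 1) y p \<partial>(angles \<Otimes>\<^sub>M shifts))" for x y
  define K where "K = (\<kappa> / (4 * pi))\<^sup>2"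
  have [measurable]: "case_prod J \<in> borel_measurable (borel \<Otimes>\<^sub>M borel)"
    unfolding J_def[abs_def] kernel_def by measurable
  \<comment> \<open>The identity is available on the disk only, so it is applied under the set
    integrals before these become integrals over \<open>disk\<close>.\<close>
  have J: "x $ i * y $ j * cov_fun \<kappa> \<sigma> \<phi> x0 (x - y) = K * J x y"
    if "x \<in> cball 0 \<rho>" "y \<in> cball 0 \<rho>" for x y
    using that by (simp add: J_def K_def kernel_def cov_fun_eq inner_axis' mult_ac flip: integral_mult_right_zero)
  have inner: "(LINT y:cball 0 \<rho>|lborel. x $ i * y $ j * cov_fun \<kappa> \<sigma> \<phi> x0 (x - y)) = (\<integral>y. K * J x y \<partial>disk)"
    if "x \<in> cball 0 \<rho>" for x
  proof -
    have "(LINT y:cball 0 \<rho>|lborel. x $ i * y $ j * cov_fun \<kappa> \<sigma> \<phi> x0 (x - y)) = (LINT y:cball 0 \<rho>|lborel. K * J x y)"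
      using J that by (intro set_lebesgue_integral_cong) auto
    also have "\<dots> = (\<integral>y. K * J x y \<partial>disk)"
      by (rule set_integral_disk) measurable
    finally show ?thesis .
  qed
  have "cov_matrix \<rho> \<kappa> \<sigma> \<phi> x0 $ i $ j
      = (LINT x:cball 0 \<rho>|lborel. LINT y:cball 0 \<rho>|lborel. x $ i * y $ j * cov_fun \<kappa> \<sigma> \<phi> x0 (x - y))"
    by (simp add: cov_matrix_def)
  also have "\<dots> = (LINT x:cball 0 \<rho>|lborel. (\<integral>y. K * J x y \<partial>disk))"
    using inner by (intro set_lebesgue_integral_cong) auto
  also have "\<dots> = (\<integral>x. (\<integral>y. K * J x y \<partial>disk) \<partial>disk)"
    by (rule set_integral_disk) measurable
  also have "\<dots> = K * (\<integral>x. (\<integral>y. J x y \<partial>disk) \<partial>disk)"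
    by simp
  also have "(\<integral>x. (\<integral>y. J x y \<partial>disk) \<partial>disk)
      = (\<integral>p. profile (axis i 1) p * profile (axis j 1) p \<partial>(angles \<Otimes>\<^sub>M shifts))"
  proof -
    obtain L where L: "\<And>x p. \<bar>kernel (axis i 1) x p\<bar> \<le> L"
      using bounded_kernel by blast
    obtain L' where L': "\<And>x p. \<bar>kernel (axis j 1) x p\<bar> \<le> L'"
      using bounded_kernel by blast
    show ?thesis
      unfolding J_def profile_def
      by (rule bilinear_Fubini[OF disk.finite_measure_axioms finite_angles_shifts _ _ L L']) measurable
  qed
  finally show ?thesis
    by (simp add: K_def)
qed

lemma cov_matrix_quadratic_form:
  "v \<bullet> (cov_matrix \<rho> \<kappa> \<sigma> \<phi> x0 *v v) = (\<kappa> / (4 * pi))\<^sup>2 *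
     (\<integral>p. (profile v p)\<^sup>2 \<partial>(angles \<Otimes>\<^sub>M shifts))"
proof -
  have "(\<integral>p. (profile v p)\<^sup>2 \<partial>(angles \<Otimes>\<^sub>M shifts))
    = (\<integral>p. (\<Sum>i\<in>UNIV. \<Sum>j\<in>UNIV. v $ i * v $ j * (profile (axis i 1) p * profile (axis j 1) p)) \<partial>(angles \<Otimes>\<^sub>M shifts))"
    by (subst profile_linear) (simp add: power2_eq_square sum_product mult_ac)
  also have "\<dots> = (\<Sum>i\<in>UNIV. \<Sum>j\<in>UNIV. v $ i * v $ j *
     (\<integral>p. profile (axis i 1) p * profile (axis j 1) p \<partial>(angles \<Otimes>\<^sub>M shifts)))"
    by (simp add: Bochner_Integration.integral_sum integrable_profile_mult)
  finally show ?thesis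
    by (simp add: inner_vec_def matrix_vector_mult_def cov_matrix_entry sum_distrib_left mult_ac)
qed

section \<open>Second moments and definiteness\<close>

lemma integral_disk_inner:
  "(\<integral>x. v \<bullet> x \<partial>disk) = 0"
proof -
  have "(\<integral>x. v \<bullet> x \<partial>disk) = (\<integral>x. indicator (cball 0 \<rho>) x *\<^sub>R (v \<bullet> x) \<partial>lborel)"
    unfolding disk_def by (rule integral_density) auto
  also have "\<dots> = 0"
    by (rule integral_lborel_odd) (auto simp: indicator_def)
  finally show ?thesis .
qed

lemma integral_disk_indicator:
  fixes f :: "real^2 \<Rightarrow> real"
  assumes [measurable]: "f \<in> borel_measurable borel"
  shows "(\<integral>x. indicator (cball 0 \<rho>) x * f x \<partial>disk) = (\<integral>x. f x \<partial>disk)"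
proof (rule integral_cong_AE)
  show "AE x in disk. indicator (cball 0 \<rho>) x * f x = f x"
    unfolding disk_def by (subst AE_density) (auto simp: indicator_def)
qed measurable

lemma integrable_disk:
  fixes f :: "real^2 \<Rightarrow> real"
  assumes "continuous_on UNIV f"
  shows "integrable disk f"
proof -
  have [measurable]: "f \<in> borel_measurable borel"
    using assms by (rule borel_measurable_continuous_onI)
  have "integrable lborel (\<lambda>x. indicator (cball 0 \<rho>) x *\<^sub>R f x)"
    using assms by (intro borel_integrable_compact) (auto intro: continuous_on_subset)
  then show ?thesis
    unfolding disk_def by (subst integrable_density) auto
qed

text \<open>The second moment of a profile in the shift variable sees only \<open>\<integral>\<phi> = 1\<close>: the first moment of
  \<open>\<phi>\<close> is multiplied by the integral over the disk of an odd function.\<close>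

lemma profile_second_moment:
  "(\<integral>s. indicator {- (R + \<rho>)..R + \<rho>} s * s\<^sup>2 * profile v (a, s) \<partial>shifts) = 2 * (\<integral>x. (v \<bullet> x) * (x \<bullet> dir a) \<partial>disk)"
proof -
  define T where "T = R + \<rho>"
  define \<mu> where "\<mu> = (\<integral>u. u * \<phi> u \<partial>lborel)"
  interpret P: finite_measure "disk \<Otimes>\<^sub>M shifts"
    by (rule finite_measure_pair_measure) unfold_locales
  obtain L where L: "\<And>x p. \<bar>kernel v x p\<bar> \<le> L"
    using bounded_kernel by blast
  \<comment> \<open>The cutoff makes \<open>s\<^sup>2\<close> bounded, so that Fubini applies on a
    finite product measure. It is dropped below, where \<open>\<psi>\<close> already vanishes
    outside \<open>{- T..T}\<close>.\<close>
  have "\<bar>indicator {- T..T} s * s\<^sup>2\<bar> \<le> T\<^sup>2" for s :: real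
    by (auto simp: abs_le_square_iff[symmetric] split: split_indicator)
  moreover have "(\<lambda>(x, s). kernel v x (a, s)) \<in> borel_measurable (disk \<Otimes>\<^sub>M shifts)"
    unfolding kernel_def fst_conv snd_conv by measurable
  ultimately have "integrable (disk \<Otimes>\<^sub>M shifts) (\<lambda>(x, s). indicator {- T..T} s * s\<^sup>2 * kernel v x (a, s))"
    using L by (intro P.integrable_const_bound[where B = "T\<^sup>2 * L"])
      (auto simp: abs_mult intro!: AE_I2 mult_mono)
  from disk_shifts.Fubini_integral[OF this]
  have "(\<integral>s. indicator {- T..T} s * s\<^sup>2 * profile v (a, s) \<partial>shifts)
      = (\<integral>x. (\<integral>s. indicator {- T..T} s * s\<^sup>2 * kernel v x (a, s) \<partial>shifts) \<partial>disk)"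
    by (simp add: profile_def)
  also have "\<dots> = (\<integral>x. indicator (cball 0 \<rho>) x * ((v \<bullet> x) * (2 * (x \<bullet> dir a) - 2 * \<mu>)) \<partial>disk)"
  proof (intro Bochner_Integration.integral_cong refl)
    fix x :: "real^2"
    have "(\<integral>s. indicator {- T..T} s * s\<^sup>2 * kernel v x (a, s) \<partial>shifts)
        = indicator (cball 0 \<rho>) x * (v \<bullet> x) * (\<integral>s. indicator {- T..T} s * s\<^sup>2 * \<psi> (x \<bullet> dir a + s) \<partial>shifts)"
      by (simp add: kernel_def mult_ac flip: integral_mult_right_zero)
    also have "\<dots> = indicator (cball 0 \<rho>) x * ((v \<bullet> x) * (2 * (x \<bullet> dir a) - 2 * \<mu>))"
    proof (cases "x \<in> cball 0 \<rho>")
      case True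
      have zero: "\<psi> (x \<bullet> dir a + s) = 0" if "R + \<rho> < \<bar>s\<bar>" for s
        using inner_dir_bound[OF True, of a] that by (intro supp) auto
      have "(\<integral>s. indicator {- T..T} s * s\<^sup>2 * \<psi> (x \<bullet> dir a + s) \<partial>shifts)
         = (\<integral>s. indicator {- T..T} s * s\<^sup>2 * \<psi> (x \<bullet> dir a + s) \<partial>lborel)"
        by (intro integral_shifts) (auto simp: zero)
      also have "\<dots> = (\<integral>s. s\<^sup>2 * \<psi> (x \<bullet> dir a + s) \<partial>lborel)"
        by (intro Bochner_Integration.integral_cong) (auto simp: T_def zero split: split_indicator)
      also have "\<dots> = 2 * (x \<bullet> dir a) - 2 * \<mu>"
        unfolding \<mu>_def by (rule second_moment_deriv_translate[OF \<phi>_deriv cont supp \<phi>_int])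
      finally show ?thesis
        by simp
    qed simp
    finally show "(\<integral>s. indicator {- T..T} s * s\<^sup>2 * kernel v x (a, s) \<partial>shifts)
        = indicator (cball 0 \<rho>) x * ((v \<bullet> x) * (2 * (x \<bullet> dir a) - 2 * \<mu>))" .
  qed
  also have "\<dots> = (\<integral>x. (v \<bullet> x) * (2 * (x \<bullet> dir a) - 2 * \<mu>) \<partial>disk)"
    by (rule integral_disk_indicator) measurable
  also have "\<dots> = (\<integral>x. 2 * ((v \<bullet> x) * (x \<bullet> dir a)) - 2 * \<mu> * (v \<bullet> x) \<partial>disk)"
    by (simp add: algebra_simps)
  also have "\<dots> = 2 * (\<integral>x. (v \<bullet> x) * (x \<bullet> dir a) \<partial>disk) - 2 * \<mu> * (\<integral>x. v \<bullet> x \<partial>disk)"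
    by (subst Bochner_Integration.integral_diff) (auto intro!: integrable_disk continuous_intros)
  finally show ?thesis
    by (simp add: integral_disk_inner T_def)
qed

lemma disk_second_moment_eq_0D:
  assumes "(\<integral>x. (v \<bullet> x)\<^sup>2 \<partial>disk) = 0"
  shows "v = 0"
proof -
  have "AE x in disk. (v \<bullet> x)\<^sup>2 = 0"
    using assms by (subst (asm) integral_nonneg_eq_0_iff_AE) (auto intro!: integrable_disk continuous_intros)
  then have "AE x in lborel. x \<in> cball 0 \<rho> \<longrightarrow> v \<bullet> x = 0"
    unfolding disk_def by (subst (asm) AE_density) (auto simp: indicator_def)
  \<comment> \<open>Shrinking to the open ball permits the passage from almost all to all
    points.\<close>
  then have "AE x in lborel. x \<in> ball 0 \<rho> \<longrightarrow> x \<in> {x. v \<bullet> x = 0}"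
    by (rule eventually_mono) auto
  then have sub: "ball 0 \<rho> \<subseteq> {x. v \<bullet> x = 0}"
    by (rule AE_lborel_open_imp_closed[rotated 2]) (auto simp: closed_hyperplane)
  show ?thesis
  proof (rule ccontr)
    assume "v \<noteq> 0"
    \<comment> \<open>The multiple of \<open>v\<close> with norm \<open>\<rho> / 2\<close>, on which
      \<open>v\<close> does not vanish.\<close>
    then have "(\<rho> / (2 * norm v)) *\<^sub>R v \<in> ball 0 \<rho>"
      using \<rho> by simp
    with sub have "v \<bullet> ((\<rho> / (2 * norm v)) *\<^sub>R v) = 0"
      by blast
    with \<open>v \<noteq> 0\<close> \<rho> show False
      by simp
  qed
qed

lemma cov_matrix_quadratic_form_eq_0D:
  assumes ab: "a < b" and nz: "\<And>t. a < t \<Longrightarrow> t < b \<Longrightarrow> weight t \<noteq> 0"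
    and zero: "v \<bullet> (cov_matrix \<rho> \<kappa> \<sigma> \<phi> x0 *v v) = 0"
  shows "v = 0"
proof -
  \<comment> \<open>The image of \<open>v\<close> under the second-moment matrix of the disk. Its
    product with \<open>dir t\<close> is half the second moment of the profile at angle
    \<open>t\<close>.\<close>
  define w where "w = (\<chi> i. \<integral>x. (v \<bullet> x) * x $ i \<partial>disk)"
  have w: "w \<bullet> u = (\<integral>x. (v \<bullet> x) * (x \<bullet> u) \<partial>disk)" for u
  proof -
    have "(\<integral>x. (v \<bullet> x) * (x \<bullet> u) \<partial>disk) = (\<integral>x. (\<Sum>i\<in>UNIV. (v \<bullet> x) * x $ i * u $ i) \<partial>disk)"
      by (simp add: inner_vec_def[of _ u] sum_distrib_left mult_ac)
    also have "\<dots> = w \<bullet> u"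
      by (subst Bochner_Integration.integral_sum)
         (auto simp: w_def inner_vec_def[of _ u] intro!: integrable_disk continuous_intros)
    finally show ?thesis ..
  qed
  have "(\<integral>p. (profile v p)\<^sup>2 \<partial>(angles \<Otimes>\<^sub>M shifts)) = 0"
    using zero \<kappa> by (simp add: cov_matrix_quadratic_form)
  then have "AE p in angles \<Otimes>\<^sub>M shifts. profile v p = 0"
    using integrable_profile_mult[of v v]
    by (subst (asm) integral_nonneg_eq_0_iff_AE) (auto simp: power2_eq_square)
  then have "AE t in angles. AE s in shifts. profile v (t, s) = 0"
    by (rule angles_shifts.AE_pair)
  then have "AE t in angles. w \<bullet> dir t = 0"
  proof (rule eventually_mono)
    fix t assume *: "AE s in shifts. profile v (t, s) = 0"
    have "(\<integral>s. indicator {- (R + \<rho>)..R + \<rho>} s * s\<^sup>2 * profile v (t, s) \<partial>shifts) = 0"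
      by (rule integral_eq_zero_AE) (use * in \<open>auto elim: eventually_mono\<close>)
    then show "w \<bullet> dir t = 0"
      using profile_second_moment[of v t] w[of "dir t"] by simp
  qed
  then have "AE t in lborel. 0 < weight t \<longrightarrow> w \<bullet> dir t = 0"
    unfolding angles_def by (subst (asm) AE_density) auto
  \<comment> \<open>On the interval the weight is nonzero and hence positive, so null sets for
    \<open>angles\<close> are Lebesgue null there.\<close>
  then have "AE t in lborel. t \<in> {a<..<b} \<longrightarrow> t \<in> {t. w \<bullet> dir t = 0}"
    by (rule eventually_mono) (use nz in \<open>auto simp: less_le\<close>)
  then have "{a<..<b} \<subseteq> {t. w \<bullet> dir t = 0}"
    by (rule AE_lborel_open_imp_closed[rotated 2])
       (auto intro!: closed_Collect_eq continuous_intros continuous_on_dir)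
  then have "w = 0"
    using ab by (intro inner_dir_eq_0_on_interval) auto
  then have "(\<integral>x. (v \<bullet> x)\<^sup>2 \<partial>disk) = 0"
    using w[of v] by (simp add: power2_eq_square inner_commute)
  then show ?thesis
    by (rule disk_second_moment_eq_0D)
qed

text \<open>A vector in the kernel annihilates the quadratic form, so the kernel is trivial.\<close>

lemma invertible_cov_matrix:
  assumes "a < b" "\<And>t. a < t \<Longrightarrow> t < b \<Longrightarrow> weight t \<noteq> 0"
  shows "invertible (cov_matrix \<rho> \<kappa> \<sigma> \<phi> x0)"
  unfolding invertible_left_inverse matrix_left_invertible_ker
  using cov_matrix_quadratic_form_eq_0D[OF assms] by simp

end

section \<open>From the stated hypotheses to the locale\<close>

text \<open>For \<open>2 \<le> m\<close> both \<open>\<phi>\<close> and \<open>deriv \<phi>\<close>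
  are differentiable everywhere, and differentiability of \<open>deriv \<phi>\<close> gives its
  continuity.\<close>

lemma deriv_Suc_Linfty_C1:
  fixes \<phi> :: "real \<Rightarrow> real"
  assumes "deriv_Suc_Linfty m \<phi>" "2 \<le> m"
  shows "(\<phi> has_real_derivative deriv \<phi> t) (at t)" "continuous_on UNIV (deriv \<phi>)"
proof -
  have diff: "(deriv ^^ k) \<phi> differentiable at t" if "k < m" for k t
    using assms(1) that by (auto simp: deriv_Suc_Linfty_def)
  show "(\<phi> has_real_derivative deriv \<phi> t) (at t)"
    using diff[of 0] assms(2) by (simp add: DERIV_deriv_iff_real_differentiable)
  have "deriv \<phi> differentiable at t" for t
    using diff[of 1] assms(2) by simp
  then show "continuous_on UNIV (deriv \<phi>)"
    by (auto intro!: continuous_at_imp_continuous_on differentiable_imp_continuous_within)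
qed

text \<open>The condition \<open>R < \<bar>t\<bar>\<close> is open, so \<open>\<phi>\<close> is zero
  in a neighborhood of \<open>t\<close>.\<close>

lemma deriv_zero_outside_support:
  fixes \<phi> :: "real \<Rightarrow> real"
  assumes supp: "\<And>t. R < \<bar>t\<bar> \<Longrightarrow> \<phi> t = 0" and t: "R < \<bar>t\<bar>"
  shows "deriv \<phi> t = 0"
proof -
  have "open {s. R < \<bar>s\<bar>}"
    by (intro open_Collect_less continuous_intros)
  then have "eventually (\<lambda>s. s \<in> {s. R < \<bar>s\<bar>}) (nhds t)"
    using t by (intro eventually_nhds_in_open) auto
  then have "eventually (\<lambda>s. \<phi> s = 0) (nhds t)"
    by (rule eventually_mono) (auto simp: supp)
  then have "deriv \<phi> t = deriv (\<lambda>_. 0) t"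
    by (intro deriv_cong_ev refl)
  then show ?thesis
    by simp
qed

text \<open>Regularity is given for angles in \<open>{-pi..pi}\<close>, but the covariance
  integrates over \<open>{0..2 * pi}\<close>. Periodicity carries the negative half to
  \<open>{pi..2 * pi}\<close>, and the closed pieces are glued at \<open>pi\<close>.\<close>

lemma continuous_on_sigma_dir:
  fixes \<sigma> :: "real \<Rightarrow> real \<Rightarrow> real" and x0 :: "real^2"
  assumes "C1_on ({-pi..pi} \<times> {-P..P}) (\<lambda>(a, p). \<sigma> a p)"
    and per: "\<And>a p. p \<in> {-P..P} \<Longrightarrow> \<sigma> (a + 2 * pi) p = \<sigma> a p"
    and x0: "norm x0 < P"
  shows "continuous_on {0..2 * pi} (\<lambda>a. \<sigma> a (dir a \<bullet> x0))"
proof -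
  have \<sigma>: "continuous_on ({-pi..pi} \<times> {-P..P}) (\<lambda>(a, p). \<sigma> a p)"
    using assms(1) unfolding C1_on_def by (meson has_derivative_continuous_on)
  have range: "dir a \<bullet> x0 \<in> {-P..P}" for a
    using Cauchy_Schwarz_ineq2[of "dir a" x0] x0 by (auto simp: norm_dir abs_le_iff)
  define \<tau> where "\<tau> a = \<sigma> a (dir a \<bullet> x0)" for a
  have base: "continuous_on {-pi..pi} \<tau>"
  proof -
    have "continuous_on {-pi..pi} ((\<lambda>(a, p). \<sigma> a p) \<circ> (\<lambda>a. (a, dir a \<bullet> x0)))"
      by (intro continuous_on_compose continuous_intros continuous_on_dir continuous_on_subset[OF \<sigma>])
         (use range in auto)
    then show ?thesis
      by (simp add: o_def \<tau>_def[abs_def])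
  qed
  have periodic: "\<tau> (a - 2 * pi) = \<tau> a" for a
  proof -
    have "dir (a - 2 * pi) = dir a"
      by (simp add: dir_def cos_diff sin_diff)
    then show ?thesis
      using per[OF range[of a], of "a - 2 * pi"] by (simp add: \<tau>_def)
  qed
  have "continuous_on {pi..2 * pi} (\<tau> \<circ> (\<lambda>a. a - 2 * pi))"
    by (intro continuous_on_compose continuous_intros continuous_on_subset[OF base]) auto
  then have "continuous_on {pi..2 * pi} \<tau>"
    by (simp add: o_def periodic)
  moreover have "continuous_on {0..pi} \<tau>"
    by (rule continuous_on_subset[OF base]) auto
  ultimately have "continuous_on ({0..pi} \<union> {pi..2 * pi}) \<tau>"
    by (intro continuous_on_closed_Un) auto
  also have "{0..pi} \<union> {pi..2 * pi} = {0..2 * pi}"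
    by (auto intro: order_trans)
  finally show ?thesis
    by (simp add: \<tau>_def[abs_def])
qed

text \<open>The given point may be an endpoint, so the ball around it is cut down to
  \<open>{l<..<u}\<close>. The result is still a nonempty open interval.\<close>

lemma openin_Icc_contains_interval:
  fixes l u :: real
  assumes U: "openin (top_of_set {l..u}) U" "U \<noteq> {}" and "l < u"
  obtains a b where "a < b" "{a<..<b} \<subseteq> U"
proof -
  obtain x where x: "x \<in> U"
    using U by auto
  then obtain e where e: "0 < e" "ball x e \<inter> {l..u} \<subseteq> U"
    using U(1) by (auto simp: openin_contains_ball)
  have "x \<in> {l..u}"
    using x U(1) openin_imp_subset by blast
  then have "max l (x - e) < min u (x + e)"
    using e \<open>l < u\<close> by auto
  moreover have "{max l (x - e)<..<min u (x + e)} \<subseteq> ball x e \<inter> {l..u}"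
    by (auto simp: dist_real_def abs_less_iff)
  ultimately show ?thesis
    using e that by blast
qed

theorem theorem4p3:
  fixes \<rho> \<kappa> P \<alpha> :: real and M :: nat
    and \<sigma> :: "real \<Rightarrow> real \<Rightarrow> real" and \<phi> :: "real \<Rightarrow> real" and x0 :: "real^2"
  assumes "\<rho> > 0" and "\<kappa> > 0" and "P > 0"
    and sigma_C1: "C1_on ({-pi..pi} \<times> {-P..P}) (\<lambda>(a, p). \<sigma> a p)"
    and sigma_periodic: "\<And>a p. p \<in> {-P..P} \<Longrightarrow> \<sigma> (a + 2 * pi) p = \<sigma> a p"
    and sigma_even: "\<And>a p. p \<in> {-P..P} \<Longrightarrow> \<sigma> a p = \<sigma> (a + pi) (- p)"
    and x0: "norm x0 < P"
    and sigma_nonzero: "\<exists>U. openin (top_of_set {0..2 * pi}) U \<and> U \<noteq> {} \<and>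
           (\<forall>a\<in>U. (\<sigma> a (dir a \<bullet> x0))\<^sup>2 \<noteq> 0)"
    and phi_supp: "compact (closure {t. \<phi> t \<noteq> 0})"
    and M: "M \<ge> 3"
    and phi_smooth: "deriv_Suc_Linfty M \<phi>"
    and phi_exact: "\<And>j t. j \<in> {0, 1::nat} \<Longrightarrow>
           ((\<lambda>k::int. \<phi> (t - of_int k) * of_int k ^ j) has_sum t ^ j) UNIV"
    and alpha: "0 < \<alpha>" "\<alpha> < 1"
  shows "confidence_region (cov_matrix \<rho> \<kappa> \<sigma> \<phi> x0) (1 - \<alpha>)
           (CR_ellipse (cov_matrix \<rho> \<kappa> \<sigma> \<phi> x0) \<alpha>) \<and>
         (\<forall>(\<Omega> :: 's measure) (F :: 's \<Rightarrow> real^2) (H :: real^2).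
            prob_space \<Omega> \<longrightarrow> normal_vector \<Omega> F H (cov_matrix \<rho> \<kappa> \<sigma> \<phi> x0) \<longrightarrow>
            measure \<Omega> {\<omega> \<in> space \<Omega>. H \<in> CR_ellipse (cov_matrix \<rho> \<kappa> \<sigma> \<phi> x0) \<alpha> (F \<omega>)} \<ge> 1 - \<alpha>)"
proof -
  obtain R where R: "\<And>t. \<phi> t \<noteq> 0 \<Longrightarrow> \<bar>t\<bar> \<le> R"
    using compact_imp_bounded[OF phi_supp] closure_subset[of "{t. \<phi> t \<noteq> 0}"]
    unfolding bounded_iff by (metis (mono_tags) mem_Collect_eq real_norm_def subsetD)
  then have supp: "\<phi> t = 0" if "R < \<bar>t\<bar>" for t
    using that by (meson not_le)
  note deriv = deriv_Suc_Linfty_C1[OF phi_smooth] M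
  have "continuous_on UNIV \<phi>"
    using deriv by (auto intro!: continuous_at_imp_continuous_on DERIV_isCont)
  \<comment> \<open>Exactness for \<open>j = 0\<close> is the partition of unity.\<close>
  then have "(\<integral>t. \<phi> t \<partial>lborel) = 1"
    using supp phi_exact[of 0] by (intro partition_of_unity_integral) auto
  then interpret edge_covariance \<rho> \<kappa> R \<sigma> \<phi> x0
    using assms(1,2) deriv supp continuous_on_sigma_dir[OF sigma_C1 sigma_periodic x0]
    by unfold_locales (auto intro: deriv_zero_outside_support)
  obtain U where U: "openin (top_of_set {0..2 * pi}) U" "U \<noteq> {}"
    and nz: "\<And>a. a \<in> U \<Longrightarrow> (\<sigma> a (dir a \<bullet> x0))\<^sup>2 \<noteq> 0"
    using sigma_nonzero by blast
  obtain a b where ab: "a < b" "{a<..<b} \<subseteq> U"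
    using U by (rule openin_Icc_contains_interval) auto
  have "invertible (cov_matrix \<rho> \<kappa> \<sigma> \<phi> x0)"
  proof (rule invertible_cov_matrix[OF ab(1)])
    fix t assume "a < t" "t < b"
    then have "t \<in> U"
      using ab by auto
    \<comment> \<open>\<open>U\<close> lies in \<open>{0..2 * pi}\<close>, so the indicator in
      \<open>weight\<close> is 1 at \<open>t\<close>.\<close>
    then show "weight t \<noteq> 0"
      using nz[of t] openin_imp_subset[OF U(1)] by (auto simp: weight_def)
  qed
  from confidence_region_CR_ellipse[OF this alpha] show ?thesis
    by (auto intro: confidence_region_normal_vector)
qed

end
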